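(* Let $n\geq 5$ and let $H$ be a $K_{2,2}$-minor free spanning subgraph of $K_n$ such that the signed complete graph $\Gamma=(K_n,H^-)$ is unbalanced. If $\Gamma$ is switching isomorphic neither to $(K_n,U_1^-)$ nor to $(K_n,D_{1,n-3}^-)$, then $$\lambda_1(A((K_n,U_1^-)))>\lambda_1(A((K_n,D_{1,n-3}^-)))>\lambda_1(A(\Gamma)).$$
   Context: For a spanning subgraph $H$ of $K_n$, $(K_n,H^-)$ denotes the signed complete graph on $n$ vertices in which the edges of $H$ are negative (sign $-1$) and all other edges of $K_n$ are positive (sign $+1$). Its adjacency matrix $A$ has entry $\sigma(uv)\in\{\pm1\}$ for $u\neq v$ and $0$ on the diagonal; $\lambda_1(A(\cdot))$ is its largest eigenvalue (the index). A signed graph is balanced if every cycle contains an even number of negative edges, and unbalanced otherwise. Switching at a vertex subset $U$ reverses the signs of all edges between $U$ and its complement; two signed graphs are switching isomorphic if one is isomorphic to a signed graph obtained from the other by switching. A graph is $K_{2,2}$-minor free if no minor of it (obtained by deleting vertices, deleting edges and contracting edges) is isomorphic to $K_{2,2}$ ($=C_4$). $U_1$ is the graph on $n$ vertices consisting of a triangle $v_1v_2v_3$ together with $n-3$ pendant vertices all adjacent to $v_1$. $D_{1,n-3}$ is the tree on $n$ vertices obtained from a path $P_3$ by attaching $n-3$ pendant vertices to one end vertex of the path. *)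

theory Defs
  imports "HOL-Library.Ramsey" "Jordan_Normal_Form.Char_Poly"
begin

section \<open>Simple graphs, isomorphism and minors\<close>

text \<open>Edges are two-element sets of vertices; \<^term>\<open>nsets V 2\<close>, from
  \<^theory>\<open>HOL-Library.Ramsey\<close>, is the set of all two-element subsets of \<^term>\<open>V\<close>.\<close>

record 'a graph =
  vertices :: "'a set"
  edges :: "'a set set"

definition complete_graph :: "nat \<Rightarrow> nat graph" where
  "complete_graph n = \<lparr>vertices = {..<n}, edges = nsets {..<n} 2\<rparr>"

definition spanning_subgraph :: "'a graph \<Rightarrow> 'a graph \<Rightarrow> bool" where
  "spanning_subgraph H G \<longleftrightarrow> vertices H = vertices G \<and> edges H \<subseteq> edges G"

definition is_graph_iso ::
  "('a \<Rightarrow> 'b) \<Rightarrow> ('a, 'm) graph_scheme \<Rightarrow> ('b, 'k) graph_scheme \<Rightarrow> bool" where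
  "is_graph_iso f G G' \<longleftrightarrow>
     bij_betw f (vertices G) (vertices G') \<and> edges G' = (\<lambda>e. f ` e) ` edges G"

definition graph_isomorphic :: "'a graph \<Rightarrow> 'b graph \<Rightarrow> bool" where
  "graph_isomorphic G G' \<longleftrightarrow> (\<exists>f. is_graph_iso f G G')"

definition delete_vertex :: "'a \<Rightarrow> 'a graph \<Rightarrow> 'a graph" where
  "delete_vertex v G = \<lparr>vertices = vertices G - {v}, edges = {e \<in> edges G. v \<notin> e}\<rparr>"

definition delete_edge :: "'a set \<Rightarrow> 'a graph \<Rightarrow> 'a graph" where
  "delete_edge e G = \<lparr>vertices = vertices G, edges = edges G - {e}\<rparr>"

text \<open>Contraction of the edge \<^term>\<open>{u, v}\<close> identifies \<^term>\<open>v\<close> with \<^term>\<open>u\<close>. The loop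
  that would arise is dropped, and parallel edges coincide because edges form a set.\<close>

definition contract_edge :: "'a \<Rightarrow> 'a \<Rightarrow> 'a graph \<Rightarrow> 'a graph" where
  "contract_edge u v G =
     \<lparr>vertices = vertices G - {v},
      edges = (\<lambda>e. (\<lambda>x. if x = v then u else x) ` e) ` (edges G - {{u, v}})\<rparr>"

inductive is_minor :: "'a graph \<Rightarrow> 'a graph \<Rightarrow> bool" for G :: "'a graph" where
  minor_refl: "is_minor G G"
| minor_delete_vertex:
    "is_minor G M \<Longrightarrow> v \<in> vertices M \<Longrightarrow> is_minor G (delete_vertex v M)"
| minor_delete_edge:
    "is_minor G M \<Longrightarrow> e \<in> edges M \<Longrightarrow> is_minor G (delete_edge e M)"
| minor_contract_edge:
    "is_minor G M \<Longrightarrow> u \<noteq> v \<Longrightarrow> {u, v} \<in> edges M \<Longrightarrow> is_minor G (contract_edge u v M)"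

definition minor_free :: "'b graph \<Rightarrow> 'a graph \<Rightarrow> bool" where
  "minor_free F G \<longleftrightarrow> \<not> (\<exists>M. is_minor G M \<and> graph_isomorphic M F)"

definition K22 :: "nat graph" where
  "K22 = \<lparr>vertices = {0, 1, 2, 3}, edges = {{0, 2}, {0, 3}, {1, 2}, {1, 3}}\<rparr>"

section \<open>Signed graphs\<close>

text \<open>Only the values of \<open>esign\<close> on edges are meaningful.\<close>

record 'a signed_graph = "'a graph" +
  esign :: "'a set \<Rightarrow> int"

definition signed_complete :: "nat \<Rightarrow> nat graph \<Rightarrow> nat signed_graph" where
  "signed_complete n H =
     \<lparr>vertices = vertices (complete_graph n), edges = edges (complete_graph n),
      esign = (\<lambda>e. if e \<in> edges H then - 1 else 1)\<rparr>"

text \<open>A cycle is given by the list of its vertices in cyclic order.\<close>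

definition cycle_edges :: "'a list \<Rightarrow> 'a set set" where
  "cycle_edges vs = {{vs ! i, vs ! (Suc i mod length vs)} | i. i < length vs}"

definition is_cycle :: "('a, 'm) graph_scheme \<Rightarrow> 'a list \<Rightarrow> bool" where
  "is_cycle G vs \<longleftrightarrow>
     3 \<le> length vs \<and> distinct vs \<and> set vs \<subseteq> vertices G \<and> cycle_edges vs \<subseteq> edges G"

definition balanced :: "'a signed_graph \<Rightarrow> bool" where
  "balanced \<Gamma> \<longleftrightarrow>
     (\<forall>vs. is_cycle \<Gamma> vs \<longrightarrow> even (card {e \<in> cycle_edges vs. esign \<Gamma> e = - 1}))"

definition switch :: "'a set \<Rightarrow> 'a signed_graph \<Rightarrow> 'a signed_graph" where
  "switch U \<Gamma> =
     \<Gamma>\<lparr>esign := (\<lambda>e. if e \<inter> U \<noteq> {} \<and> e - U \<noteq> {} then - esign \<Gamma> e else esign \<Gamma> e)\<rparr>"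

definition signed_isomorphic :: "'a signed_graph \<Rightarrow> 'b signed_graph \<Rightarrow> bool" where
  "signed_isomorphic \<Gamma> \<Delta> \<longleftrightarrow>
     (\<exists>f. is_graph_iso f \<Gamma> \<Delta> \<and> (\<forall>e \<in> edges \<Gamma>. esign \<Delta> (f ` e) = esign \<Gamma> e))"

definition switching_isomorphic :: "'a signed_graph \<Rightarrow> 'b signed_graph \<Rightarrow> bool" where
  "switching_isomorphic \<Gamma> \<Delta> \<longleftrightarrow>
     (\<exists>U \<subseteq> vertices \<Delta>. signed_isomorphic \<Gamma> (switch U \<Delta>))"

section \<open>Adjacency matrix and index\<close>

text \<open>For signed graphs with vertex set \<open>{0, ..., n - 1}\<close>. Diagonal entries are \<open>0\<close>, since
  the singleton \<^term>\<open>{i, i}\<close> is not an edge.\<close>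

definition adjacency_matrix :: "nat signed_graph \<Rightarrow> real mat" where
  "adjacency_matrix \<Gamma> =
     mat (card (vertices \<Gamma>)) (card (vertices \<Gamma>))
       (\<lambda>(i, j). if {i, j} \<in> edges \<Gamma> then of_int (esign \<Gamma> {i, j}) else 0)"

text \<open>The set of real eigenvalues is finite; it is nonempty when the matrix is symmetric of
  positive dimension, which is the only case in which \<open>largest_eigenvalue\<close> is used.\<close>

definition largest_eigenvalue :: "real mat \<Rightarrow> real" where
  "largest_eigenvalue A = Max {k. eigenvalue A k}"

section \<open>The two extremal graphs\<close>

text \<open>In \<open>U1 n\<close> the vertices \<open>0, 1, 2\<close> are \<open>v\<^sub>1, v\<^sub>2, v\<^sub>3\<close>. \<open>D1 n\<close> is \<open>D\<^bsub>1,n-3\<^esub>\<close>, on the path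
  \<open>0 - 1 - 2\<close>, with the pendant vertices attached to its end vertex \<open>0\<close>.\<close>

definition U1 :: "nat \<Rightarrow> nat graph" where
  "U1 n = \<lparr>vertices = {..<n},
     edges = {{0, 1}, {0, 2}, {1, 2}} \<union> {{0, i} | i. 3 \<le> i \<and> i < n}\<rparr>"

definition D1 :: "nat \<Rightarrow> nat graph" where
  "D1 n = \<lparr>vertices = {..<n},
     edges = {{0, 1}, {1, 2}} \<union> {{0, i} | i. 3 \<le> i \<and> i < n}\<rparr>"

end

theory Submission
  imports Defs "HOL-Analysis.Function_Topology"
begin

text \<open>Let \<open>f\<close> be an eigenvector for the index \<open>k\<close> of \<open>\<Gamma>\<close>. Switching at the vertices where \<open>f\<close> is
  negative makes \<open>f\<close> nonnegative; let \<open>G\<close> be the set of negative edges afterwards. Making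
  negative edges positive can now only increase the quadratic form at \<open>f\<close>. If \<open>G\<close> is empty, then
  \<open>\<Gamma>\<close> is balanced; a single edge and a path on three vertices are the switching classes of \<open>U\<^sub>1\<close>
  and \<open>D\<^bsub>1,n-3\<^esub>\<close>. Otherwise \<open>G\<close> properly contains such a path, or it contains two disjoint edges
  \<open>ab\<close>, \<open>cd\<close>, where for \<open>f c \<le> f a\<close> the form does not decrease when \<open>ab\<close> is replaced by \<open>bc\<close>.
  Either way \<open>k\<close> is at most the index of a negative path, and equality would make \<open>f\<close> an
  eigenvector of that path, whose nonnegative top eigenvectors vanish at most at the centre.\<close>

section \<open>The Rayleigh principle\<close>

definition quad_form :: "nat \<Rightarrow> (nat \<Rightarrow> nat \<Rightarrow> real) \<Rightarrow> (nat \<Rightarrow> real) \<Rightarrow> real" where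
  "quad_form n M f = (\<Sum>i<n. \<Sum>j<n. M i j * f i * f j)"

definition sq_norm :: "nat \<Rightarrow> (nat \<Rightarrow> real) \<Rightarrow> real" where
  "sq_norm n f = (\<Sum>i<n. (f i)\<^sup>2)"

text \<open>The zero function qualifies, so nonvanishing is stated separately wherever an
  eigenvector is meant. Only the values below \<open>n\<close> matter.\<close>

definition is_eigenfun :: "nat \<Rightarrow> (nat \<Rightarrow> nat \<Rightarrow> real) \<Rightarrow> real \<Rightarrow> (nat \<Rightarrow> real) \<Rightarrow> bool" where
  "is_eigenfun n M k f \<longleftrightarrow> (\<forall>i<n. (\<Sum>j<n. M i j * f j) = k * f i)"

definition index :: "nat \<Rightarrow> (nat \<Rightarrow> nat \<Rightarrow> real) \<Rightarrow> real" where
  "index n M = largest_eigenvalue (mat n n (\<lambda>(i, j). M i j))"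

lemma sq_norm_nonneg: "0 \<le> sq_norm n f"
  by (simp add: sq_norm_def sum_nonneg)

lemma sq_norm_eq_0_iff: "sq_norm n f = 0 \<longleftrightarrow> (\<forall>i<n. f i = 0)"
  by (auto simp: sq_norm_def sum_nonneg_eq_0_iff)

lemma sq_norm_pos_iff: "0 < sq_norm n f \<longleftrightarrow> (\<exists>i<n. f i \<noteq> 0)"
  using sq_norm_nonneg[of n f] sq_norm_eq_0_iff[of n f] by (auto simp: less_le)

lemma quad_form_eigenfun:
  assumes "is_eigenfun n M k f"
  shows "quad_form n M f = k * sq_norm n f"
proof -
  have "quad_form n M f = (\<Sum>i<n. f i * (\<Sum>j<n. M i j * f j))"
    by (simp add: quad_form_def sum_distrib_left algebra_simps)
  also have "\<dots> = (\<Sum>i<n. f i * (k * f i))"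
    using assms by (intro sum.cong) (auto simp: is_eigenfun_def)
  finally show ?thesis
    by (simp add: sq_norm_def sum_distrib_left power2_eq_square algebra_simps)
qed

lemma eigenvalue_mat_iff:
  "eigenvalue (mat n n (\<lambda>(i, j). M i j)) k \<longleftrightarrow> (\<exists>f. (\<exists>i<n. f i \<noteq> 0) \<and> is_eigenfun n M k f)"
  (is "eigenvalue ?A k \<longleftrightarrow> ?R")
proof
  assume "eigenvalue ?A k"
  then obtain v where v: "v \<in> carrier_vec n" "v \<noteq> 0\<^sub>v n" "?A *\<^sub>v v = k \<cdot>\<^sub>v v"
    by (auto simp: eigenvalue_def eigenvector_def)
  have "(\<Sum>j<n. M i j * vec_index v j) = k * vec_index v i" if "i < n" for i
  proof -
    have "vec_index (?A *\<^sub>v v) i = (\<Sum>j<n. M i j * vec_index v j)"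
      using that v(1) by (simp add: scalar_prod_def lessThan_atLeast0)
    then show ?thesis
      using v that by simp
  qed
  moreover have "\<exists>i<n. vec_index v i \<noteq> 0"
    using v(1,2) by (metis carrier_vecD eq_vecI index_zero_vec)
  ultimately show ?R
    by (auto simp: is_eigenfun_def)
next
  assume ?R
  then obtain f i where f: "i < n" "f i \<noteq> 0" "is_eigenfun n M k f"
    by blast
  have "?A *\<^sub>v vec n f = k \<cdot>\<^sub>v vec n f"
    using f(3) by (intro eq_vecI) (auto simp: is_eigenfun_def scalar_prod_def lessThan_atLeast0)
  moreover have "vec n f \<noteq> 0\<^sub>v n"
    using f(1,2) by (metis index_vec index_zero_vec(1))
  ultimately show "eigenvalue ?A k"
    unfolding eigenvalue_def eigenvector_def by (intro exI[of _ "vec n f"]) simp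
qed

text \<open>Functions vanishing outside \<open>{..<n}\<close> with values in \<open>[-1, 1]\<close> form a compact set in the
  product topology, so the quadratic form attains its maximum on the unit sphere.\<close>

lemma quad_form_maximizer:
  assumes "0 < n"
  obtains f where "sq_norm n f = 1" "\<And>g. quad_form n M g \<le> quad_form n M f * sq_norm n g"
proof -
  define B where "B = Pi\<^sub>E UNIV (\<lambda>i::nat. if i < n then {-1..1::real} else {0})"
  define S where "S = B \<inter> {f. sq_norm n f = 1}"
  have "compactin (product_topology (\<lambda>i::nat. euclidean :: real topology) UNIV) B"
    unfolding B_def by (subst compactin_PiE) auto
  then have "compact B"
    by (simp add: euclidean_product_topology)
  have cont: "continuous_on UNIV (\<lambda>f::nat \<Rightarrow> real. f i)" for i
    by (rule continuous_on_product_coordinates)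
  have contN: "continuous_on UNIV (sq_norm n)"
    unfolding sq_norm_def by (intro continuous_intros cont)
  have contQ: "continuous_on UNIV (quad_form n M)"
    unfolding quad_form_def by (intro continuous_intros cont)
  have "closed {f. sq_norm n f = 1}"
    using contN by (intro closed_Collect_eq continuous_on_const) auto
  then have "compact S"
    unfolding S_def using \<open>compact B\<close> by (rule compact_Int_closed[rotated])
  \<comment> \<open>The first basis vector witnesses that \<open>S\<close> is nonempty; it lies in
    \<open>S\<close> because \<open>0 < n\<close>.\<close>
  moreover have "(\<lambda>i. if i = 0 then 1 else 0) \<in> S"
  proof -
    have "sq_norm n (\<lambda>i. if i = 0 then 1 else 0) = (\<Sum>i<n. if i = 0 then 1 else 0)"
      unfolding sq_norm_def by (intro sum.cong) auto
    then show ?thesis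
      using assms by (auto simp: S_def B_def)
  qed
  ultimately obtain f where f: "f \<in> S" "\<And>g. g \<in> S \<Longrightarrow> quad_form n M g \<le> quad_form n M f"
    using continuous_attains_sup[of S "quad_form n M"] continuous_on_subset[OF contQ] by blast
  have "quad_form n M g \<le> quad_form n M f * sq_norm n g" for g
  proof (cases "sq_norm n g = 0")
    case True
    then have "\<forall>i<n. g i = 0"
      by (simp add: sq_norm_eq_0_iff)
    then show ?thesis
      using True by (simp add: quad_form_def)
  next
    case False
    \<comment> \<open>By homogeneity it suffices to treat \<open>g / r\<close>, cut off outside
      \<open>{..<n}\<close> so that it lies in \<open>S\<close>; norm and form both scale by
      \<open>1 / r\<^sup>2\<close>.\<close>
    define r where "r = sqrt (sq_norm n g)"
    have r: "0 < r" "r\<^sup>2 = sq_norm n g"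
      using False sq_norm_nonneg[of n g] by (auto simp: r_def less_le)
    define h where "h i = (if i < n then g i / r else 0)" for i
    have Nh: "sq_norm n h = sq_norm n g / r\<^sup>2"
      by (simp add: sq_norm_def h_def power_divide sum_divide_distrib)
    have Qh: "quad_form n M h = quad_form n M g / r\<^sup>2"
      by (simp add: quad_form_def h_def sum_divide_distrib power2_eq_square)
    have N1: "sq_norm n h = 1"
      using Nh r(2) False by simp
    have "\<bar>h i\<bar> \<le> 1" if "i < n" for i
    proof -
      have "(h i)\<^sup>2 \<le> sq_norm n h"
        unfolding sq_norm_def using that by (intro member_le_sum) auto
      then show ?thesis
        using N1 by (simp add: abs_square_le_1)
    qed
    then have "h \<in> S"
      using N1 by (auto simp: S_def B_def abs_le_iff) (auto simp: h_def)
    from f(2)[OF this] show ?thesis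
      using zero_less_power[OF r(1), of 2] by (simp add: Qh pos_divide_le_eq flip: r(2))
  qed
  moreover have "sq_norm n f = 1"
    using f(1) by (simp add: S_def)
  ultimately show thesis
    using that by blast
qed

text \<open>The first variation in the direction of the residual \<open>h = M g - L g\<close> is \<open>2 |h|\<^sup>2\<close>.\<close>

lemma rayleigh_equality:
  assumes sym: "\<And>i j. i < n \<Longrightarrow> j < n \<Longrightarrow> M i j = M j i"
    and le: "\<And>g. quad_form n M g \<le> L * sq_norm n g"
    and eq: "quad_form n M g = L * sq_norm n g"
  shows "is_eigenfun n M L g"
proof -
  define h where "h i = (\<Sum>j<n. M i j * g j) - L * g i" for i
  define c where "c = quad_form n M h - L * sq_norm n h"
  \<comment> \<open>Symmetry of \<open>M\<close> merges the two mixed terms of the expansion around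
    \<open>g\<close>.\<close>
  have cross: "(\<Sum>i<n. \<Sum>j<n. M i j * g i * h j) = (\<Sum>i<n. \<Sum>j<n. M i j * h i * g j)"
    by (subst sum.swap) (intro sum.cong refl, auto simp: sym)
  have split: "(\<Sum>i<n. \<Sum>j<n. M i j * h i * g j) - L * (\<Sum>i<n. g i * h i) = sq_norm n h"
  proof -
    have "(\<Sum>i<n. \<Sum>j<n. M i j * h i * g j) = (\<Sum>i<n. h i * (\<Sum>j<n. M i j * g j))"
      by (simp add: sum_distrib_left algebra_simps)
    also have "\<dots> = (\<Sum>i<n. h i * (h i + L * g i))"
      by (simp add: h_def)
    finally show ?thesis
      by (simp add: sq_norm_def algebra_simps sum.distrib sum_distrib_left power2_eq_square)
  qed
  \<comment> \<open>The defect \<open>Q - L N\<close> is at most 0 at \<open>g + t h\<close> and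
    equals 0 at \<open>t = 0\<close>; here it is expanded in powers of \<open>t\<close>.\<close>
  have var: "2 * t * sq_norm n h + t\<^sup>2 * c \<le> 0" for t
  proof -
    have "quad_form n M (\<lambda>i. g i + t * h i) = quad_form n M g
        + t * (\<Sum>i<n. \<Sum>j<n. M i j * g i * h j) + t * (\<Sum>i<n. \<Sum>j<n. M i j * h i * g j)
        + t\<^sup>2 * quad_form n M h"
      by (simp add: quad_form_def algebra_simps sum.distrib sum_distrib_left power2_eq_square)
    moreover have "sq_norm n (\<lambda>i. g i + t * h i)
        = sq_norm n g + 2 * t * (\<Sum>i<n. g i * h i) + t\<^sup>2 * sq_norm n h"
      by (simp add: sq_norm_def algebra_simps sum.distrib sum_distrib_left power2_eq_square)
    moreover have "(\<Sum>i<n. \<Sum>j<n. M i j * h i * g j) = sq_norm n h + L * (\<Sum>i<n. g i * h i)"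
      using split by simp
    ultimately have "L * sq_norm n g + 2 * t * (sq_norm n h + L * (\<Sum>i<n. g i * h i))
        + t\<^sup>2 * quad_form n M h
      \<le> L * (sq_norm n g + 2 * t * (\<Sum>i<n. g i * h i) + t\<^sup>2 * sq_norm n h)"
      using le[of "\<lambda>i. g i + t * h i"] unfolding eq cross by simp
    then show ?thesis
      unfolding c_def by (simp only: distrib_left right_diff_distrib) (simp add: mult.left_commute)
  qed
  have "sq_norm n h = 0"
  proof (rule ccontr)
    assume "sq_norm n h \<noteq> 0"
    then have p: "0 < sq_norm n h"
      using sq_norm_nonneg[of n h] by simp
    \<comment> \<open>Small enough that the quadratic term cannot cancel the linear one:
      \<open>t * \<bar>c\<bar>\<close> stays below \<open>sq_norm n h\<close>.\<close>
    define t where "t = sq_norm n h / (\<bar>c\<bar> + 1)"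
    have t: "0 < t" "t * (\<bar>c\<bar> + 1) = sq_norm n h"
      using p by (auto simp: t_def)
    have "t * (2 * sq_norm n h + t * c) \<le> 0"
      using var[of t] by (simp add: algebra_simps power2_eq_square)
    then have "2 * sq_norm n h + t * c \<le> 0"
      using t(1) by (simp add: mult_le_0_iff)
    moreover have "t * (- c) \<le> t * (\<bar>c\<bar> + 1)"
      using t(1) by (intro mult_left_mono) auto
    ultimately show False
      using t p by simp
  qed
  then show ?thesis
    by (auto simp: sq_norm_eq_0_iff is_eigenfun_def h_def)
qed

section \<open>The index as the maximal Rayleigh quotient\<close>

context
  fixes n :: nat and M :: "nat \<Rightarrow> nat \<Rightarrow> real"
  assumes n: "0 < n" and sym: "\<And>i j. i < n \<Longrightarrow> j < n \<Longrightarrow> M i j = M j i"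
begin

text \<open>The maximum \<open>L\<close> of the form on the unit sphere is an eigenvalue by
  \<open>rayleigh_equality\<close>. It bounds any eigenvalue \<open>k\<close>, because an
  eigenfunction of \<open>k\<close> has Rayleigh quotient \<open>k\<close>. Hence \<open>L\<close>
  is the index.\<close>

lemma index_eigenfun_rayleigh:
  "(\<exists>f. (\<exists>i<n. f i \<noteq> 0) \<and> is_eigenfun n M (index n M) f) \<and>
   (\<forall>g. quad_form n M g \<le> index n M * sq_norm n g)"
proof -
  obtain f where f: "sq_norm n f = 1" "\<And>g. quad_form n M g \<le> quad_form n M f * sq_norm n g"
    using quad_form_maximizer[OF n, of M] by metis
  define L where "L = quad_form n M f"
  have le: "quad_form n M g \<le> L * sq_norm n g" for g
    using f(2) by (simp add: L_def)
  have ef: "is_eigenfun n M L f"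
    by (rule rayleigh_equality[OF sym le]) (auto simp: L_def f(1))
  have nz: "\<exists>i<n. f i \<noteq> 0"
    using f(1) sq_norm_pos_iff[of n f] by simp
  let ?A = "mat n n (\<lambda>(i, j). M i j)"
  have "k \<le> L" if k: "eigenvalue ?A k" for k
  proof -
    obtain g where g: "\<exists>i<n. g i \<noteq> 0" "is_eigenfun n M k g"
      using k by (auto simp: eigenvalue_mat_iff)
    have "k * sq_norm n g \<le> L * sq_norm n g"
      using quad_form_eigenfun[OF g(2)] le[of g] by simp
    then show ?thesis
      using g(1) by (simp add: sq_norm_pos_iff[symmetric])
  qed
  moreover have "eigenvalue ?A L"
    using nz ef by (auto simp: eigenvalue_mat_iff)
  \<comment> \<open>\<open>Max\<close> requires a finite set: eigenvalues are roots of the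
    characteristic polynomial, which is monic and so nonzero.\<close>
  moreover have "finite {k. eigenvalue ?A k}"
  proof -
    have A: "?A \<in> carrier_mat n n"
      by simp
    have "char_poly ?A \<noteq> 0"
      using degree_monic_char_poly[OF A] by auto
    then show ?thesis
      by (simp add: eigenvalue_root_char_poly[OF A] poly_roots_finite)
  qed
  ultimately have "index n M = L"
    unfolding index_def largest_eigenvalue_def by (intro Max_eqI) auto
  then show ?thesis
    using nz ef le by blast
qed

lemma index_eigenfun:
  obtains f where "\<exists>i<n. f i \<noteq> 0" "is_eigenfun n M (index n M) f"
  using index_eigenfun_rayleigh by blast

lemma quad_form_le_index: "quad_form n M g \<le> index n M * sq_norm n g"
  using index_eigenfun_rayleigh by blast

text \<open>The source of strictness below: if two indices agreed, a test function would satisfy a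
  second system of eigenvalue equations.\<close>

lemma quad_form_eq_index:
  "quad_form n M g = index n M * sq_norm n g \<Longrightarrow> is_eigenfun n M (index n M) g"
  by (rule rayleigh_equality[OF sym quad_form_le_index])

end


section \<open>Sign matrices\<close>

text \<open>The underlying graph is always complete, so the set \<open>E\<close> of negative edges
  determines the signed graph.\<close>

definition sign_matrix :: "nat set set \<Rightarrow> nat \<Rightarrow> nat \<Rightarrow> real" where
  "sign_matrix E i j = (if i = j then 0 else if {i, j} \<in> E then - 1 else 1)"

lemma sign_matrix_commute: "sign_matrix E i j = sign_matrix E j i"
  by (simp add: sign_matrix_def insert_commute)

lemma adjacency_matrix_signed_complete:
  "adjacency_matrix (signed_complete n H) = mat n n (\<lambda>(i, j). sign_matrix (edges H) i j)"
  by (rule eq_matI)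
     (auto simp: adjacency_matrix_def signed_complete_def complete_graph_def sign_matrix_def)

lemma largest_eigenvalue_signed_complete:
  "largest_eigenvalue (adjacency_matrix (signed_complete n H)) = index n (sign_matrix (edges H))"
  by (simp add: adjacency_matrix_signed_complete index_def)

text \<open>Two symmetric entries drop from 1 to -1. This is the origin of the factors 2 in the rows
  and 4 in the quadratic form.\<close>

lemma sign_matrix_insert:
  assumes "a \<noteq> b" "{a, b} \<notin> E"
  shows "sign_matrix (insert {a, b} E) i j =
           sign_matrix E i j - 2 * of_bool (i = a \<and> j = b) - 2 * of_bool (i = b \<and> j = a)"
  using assms by (auto simp: sign_matrix_def doubleton_eq_iff insert_commute)

lemma row_sign_matrix_insert:
  assumes "a \<noteq> b" "{a, b} \<notin> E" "a < n" "b < n"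
  shows "(\<Sum>j<n. sign_matrix (insert {a, b} E) i j * f j) = (\<Sum>j<n. sign_matrix E i j * f j)
           - 2 * (if i = a then f b else 0) - 2 * (if i = b then f a else 0)"
proof -
  have "(\<Sum>j<n. sign_matrix (insert {a, b} E) i j * f j) =
      (\<Sum>j<n. sign_matrix E i j * f j - 2 * (if j = b then if i = a then f b else 0 else 0)
               - 2 * (if j = a then if i = b then f a else 0 else 0))"
    using assms by (intro sum.cong) (auto simp: sign_matrix_insert algebra_simps)
  also have "\<dots> = (\<Sum>j<n. sign_matrix E i j * f j)
           - 2 * (if i = a then f b else 0) - 2 * (if i = b then f a else 0)"
    using assms(3,4) by (simp add: sum_subtractf sum_distrib_left[symmetric])
  finally show ?thesis .
qed

lemma row_sign_matrix_empty:
  assumes "i < n"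
  shows "(\<Sum>j<n. sign_matrix {} i j * f j) = (\<Sum>j<n. f j) - f i"
proof -
  have "(\<Sum>j<n. sign_matrix {} i j * f j) = (\<Sum>j<n. f j - (if j = i then f i else 0))"
    by (intro sum.cong) (auto simp: sign_matrix_def)
  then show ?thesis
    using assms by (simp add: sum_subtractf)
qed

lemma quad_form_row: "quad_form n M f = (\<Sum>i<n. f i * (\<Sum>j<n. M i j * f j))"
  by (simp add: quad_form_def sum_distrib_left algebra_simps)

lemma quad_form_sign_matrix_insert:
  assumes "a \<noteq> b" "{a, b} \<notin> E" "a < n" "b < n"
  shows "quad_form n (sign_matrix (insert {a, b} E)) f
           = quad_form n (sign_matrix E) f - 4 * f a * f b"
proof -
  have "quad_form n (sign_matrix (insert {a, b} E)) f =
      (\<Sum>i<n. f i * (\<Sum>j<n. sign_matrix E i j * f j) - 2 * (if i = a then f a * f b else 0)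
               - 2 * (if i = b then f a * f b else 0))"
    unfolding quad_form_row row_sign_matrix_insert[OF assms]
    by (intro sum.cong) (auto simp: algebra_simps)
  also have "\<dots> = quad_form n (sign_matrix E) f - 4 * f a * f b"
    using assms(3,4) by (simp add: quad_form_row sum_subtractf sum_distrib_left[symmetric])
  finally show ?thesis .
qed

text \<open>For nonnegative \<open>f\<close> all products \<open>f i * f j\<close> are nonnegative,
  so the entrywise order of the matrices passes to the forms. This is why eigenfunctions are first
  switched to be nonnegative.\<close>

lemma quad_form_sign_matrix_antimono:
  assumes "E \<subseteq> E'" "\<And>i. i < n \<Longrightarrow> 0 \<le> f i"
  shows "quad_form n (sign_matrix E') f \<le> quad_form n (sign_matrix E) f"
  unfolding quad_form_def
proof (intro sum_mono)
  fix i j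
  assume "i \<in> {..<n}" "j \<in> {..<n}"
  moreover have "sign_matrix E' i j \<le> sign_matrix E i j"
    using assms(1) by (auto simp: sign_matrix_def)
  ultimately show "sign_matrix E' i j * f i * f j \<le> sign_matrix E i j * f i * f j"
    using assms(2) by (intro mult_right_mono) auto
qed

text \<open>Subtracting the two equations in row \<open>u\<close> gives a vanishing sum of
  nonnegative terms, and the term at \<open>v\<close> is \<open>2 * f v\<close>.\<close>

lemma sign_matrix_eigenfun_vanishes:
  assumes "E \<subseteq> E'" "\<And>i. i < n \<Longrightarrow> 0 \<le> f i"
    and "is_eigenfun n (sign_matrix E) k f" "is_eigenfun n (sign_matrix E') k f"
    and "{u, v} \<in> E' - E" "u \<noteq> v" "u < n" "v < n"
  shows "f v = 0"
proof -
  have "(\<Sum>j<n. (sign_matrix E u j - sign_matrix E' u j) * f j) = 0"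
    using assms(3,4,7) by (simp add: is_eigenfun_def sum_subtractf algebra_simps)
  moreover have "0 \<le> (sign_matrix E u j - sign_matrix E' u j) * f j" if "j < n" for j
    using assms(1,2) that by (intro mult_nonneg_nonneg) (auto simp: sign_matrix_def)
  ultimately have "(sign_matrix E u v - sign_matrix E' u v) * f v = 0"
    using assms(8) by (subst (asm) sum_nonneg_eq_0_iff) auto
  then show ?thesis
    using assms(5,6) by (auto simp: sign_matrix_def)
qed

section \<open>The negative path on three vertices\<close>

definition path3 :: "nat \<Rightarrow> nat \<Rightarrow> nat \<Rightarrow> nat set set" where
  "path3 b c d = {{b, c}, {c, d}}"

context
  fixes n b c d :: nat
  assumes n: "5 \<le> n" and lt: "b < n" "c < n" "d < n" and ne: "b \<noteq> c" "c \<noteq> d" "b \<noteq> d"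
begin

lemma row_path3:
  assumes "i < n"
  shows "(\<Sum>j<n. sign_matrix (path3 b c d) i j * f j) = (\<Sum>j<n. f j) - f i
    - 2 * (if i = b then f c else 0) - 2 * (if i = d then f c else 0)
    - 2 * (if i = c then f b + f d else 0)"
  using assms lt ne row_sign_matrix_insert[of b c "{{c, d}}" n i f]
    row_sign_matrix_insert[of c d "{}" n i f]
  by (auto simp: path3_def doubleton_eq_iff row_sign_matrix_empty)

lemma quad_form_path3:
  "quad_form n (sign_matrix (path3 b c d)) f
     = quad_form n (sign_matrix {}) f - 4 * f c * f d - 4 * f b * f c"
  using lt ne quad_form_sign_matrix_insert[of b c "{{c, d}}" n f]
    quad_form_sign_matrix_insert[of c d "{}" n f]
  by (auto simp: path3_def doubleton_eq_iff)

text \<open>Deleting the centre leaves an all-positive complete graph on \<open>n - 1\<close> vertices.\<close>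

lemma index_path3_ge_3: "3 \<le> index n (sign_matrix (path3 b c d))"
proof -
  let ?g = "\<lambda>i. if i = c then 0 else 1 :: real"
  let ?L = "index n (sign_matrix (path3 b c d))"
  have S: "(\<Sum>j<n. ?g j) = real n - 1"
  proof -
    have "(\<Sum>j<n. ?g j) = (\<Sum>j<n. 1 - (if j = c then 1 else 0))"
      by (intro sum.cong) auto
    then show ?thesis
      using lt by (simp add: sum_subtractf)
  qed
  have N: "sq_norm n ?g = real n - 1"
    unfolding S[symmetric] sq_norm_def by (intro sum.cong) auto
  \<comment> \<open>Both negative edges contain \<open>c\<close>, where \<open>?g\<close> is 0, so
    they do not contribute.\<close>
  have "quad_form n (sign_matrix (path3 b c d)) ?g = (\<Sum>i<n. ?g i * (real n - 2))"
    unfolding quad_form_row using S by (intro sum.cong) (auto simp: row_path3)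
  also have "\<dots> = (real n - 1) * (real n - 2)"
    unfolding sum_distrib_right[symmetric] S ..
  finally have "(real n - 1) * (real n - 2) \<le> ?L * (real n - 1)"
    using quad_form_le_index[of n "sign_matrix (path3 b c d)" ?g] n
    by (simp add: N sign_matrix_commute)
  then have "real n - 2 \<le> ?L"
    using n by (simp add: mult.commute)
  \<comment> \<open>The constant 3 comes from \<open>5 \<le> n\<close>; it makes the factor
    \<open>k - 3\<close> of the centre entry in \<open>path3_eigenfun\<close> nonnegative.\<close>
  then show ?thesis
    using n by linarith
qed

section \<open>Eigenfunctions of the negative path\<close>

text \<open>The equations at \<open>b\<close> and \<open>d\<close> coincide, so
  \<open>f b = f d\<close>. Then those at \<open>b\<close> and \<open>c\<close> form a linear system
  in \<open>f b\<close> and \<open>f c\<close> with right-hand sides \<open>S\<close> and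
  determinant \<open>(k + 1)\<^sup>2 - 8\<close>, which is positive for \<open>3 \<le> k\<close>.
  Elimination gives the two formulas; \<open>S = 0\<close> would make \<open>f\<close>
  vanish.\<close>

lemma path3_eigenfun:
  fixes f :: "nat \<Rightarrow> real" and k :: real
  defines "S \<equiv> \<Sum>j<n. f j"
  assumes k: "3 \<le> k" and nz: "\<exists>i<n. f i \<noteq> 0"
    and ef: "is_eigenfun n (sign_matrix (path3 b c d)) k f"
  shows "S \<noteq> 0"
    and "((k + 1)\<^sup>2 - 8) * f b = (k - 1) * S"
    and "f d = f b"
    and "((k + 1)\<^sup>2 - 8) * f c = (k - 3) * S"
    and "\<And>i. i < n \<Longrightarrow> i \<notin> {b, c, d} \<Longrightarrow> (k + 1) * f i = S"
proof -
  have row: "k * f i = S - f i - 2 * (if i = b then f c else 0) - 2 * (if i = d then f c else 0)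
    - 2 * (if i = c then f b + f d else 0)" if "i < n" for i
    using ef row_path3[OF that, of f] that by (simp add: is_eigenfun_def S_def)
  have eb: "(k + 1) * f b = S - 2 * f c" and ed: "(k + 1) * f d = S - 2 * f c"
    and ec: "(k + 1) * f c = S - 2 * (f b + f d)"
    using row[OF lt(1)] row[OF lt(2)] row[OF lt(3)] ne by (auto simp: algebra_simps)
  show other: "(k + 1) * f i = S" if "i < n" "i \<notin> {b, c, d}" for i
    using row[OF that(1)] that(2) by (simp add: algebra_simps)
  have "(k + 1) * f d = (k + 1) * f b"
    using eb ed by simp
  then show db: "f d = f b"
    using k by simp
  have ec': "(k + 1) * f c = S - 4 * f b"
    using ec db by simp
  have "(k + 1)\<^sup>2 * f b = (k + 1) * ((k + 1) * f b)"
    by (simp add: power2_eq_square)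
  also have "\<dots> = (k + 1) * S - 2 * ((k + 1) * f c)"
    unfolding eb by (simp add: algebra_simps)
  finally show fb: "((k + 1)\<^sup>2 - 8) * f b = (k - 1) * S"
    unfolding ec' by (simp add: algebra_simps)
  have "(k + 1)\<^sup>2 * f c = (k + 1) * ((k + 1) * f c)"
    by (simp add: power2_eq_square)
  also have "\<dots> = (k + 1) * S - 4 * ((k + 1) * f b)"
    unfolding ec' by (simp add: algebra_simps)
  finally show fc: "((k + 1)\<^sup>2 - 8) * f c = (k - 3) * S"
    unfolding eb by (simp add: algebra_simps)
  have "4\<^sup>2 \<le> (k + 1)\<^sup>2"
    using k by (intro power_mono) auto
  then have pos: "0 < (k + 1)\<^sup>2 - 8"
    by simp
  show "S \<noteq> 0"
  proof
    assume "S = 0"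
    then have "f b = 0" "f c = 0" "f d = 0" "\<And>i. i < n \<Longrightarrow> i \<notin> {b, c, d} \<Longrightarrow> f i = 0"
      using fb fc db other pos k by (auto simp: add_eq_0_iff)
    then show False
      using nz by blast
  qed
qed

text \<open>Nonnegativity forces \<open>S > 0\<close>, and the formulas above fix the signs. The
  centre is excluded because \<open>f c = 0\<close> when \<open>k = 3\<close>. For the second claim,
  the equations at \<open>c\<close> and \<open>i\<close> differ by
  \<open>2 * (f b + f d) > 0\<close>.\<close>

lemma path3_eigenfun_nonneg:
  fixes f :: "nat \<Rightarrow> real"
  assumes k: "3 \<le> k" and nz: "\<exists>i<n. f i \<noteq> 0"
    and ef: "is_eigenfun n (sign_matrix (path3 b c d)) k f"
    and nonneg: "\<And>i. i < n \<Longrightarrow> 0 \<le> f i"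
  shows "i < n \<Longrightarrow> i \<noteq> c \<Longrightarrow> 0 < f i"
    and "i < n \<Longrightarrow> i \<notin> {b, c, d} \<Longrightarrow> f c < f i"
proof -
  define S where "S = (\<Sum>j<n. f j)"
  note eqs = path3_eigenfun[OF k nz ef, folded S_def]
  have "0 \<le> S"
    unfolding S_def using nonneg by (intro sum_nonneg) auto
  with eqs(1) have S: "0 < S"
    by simp
  have "4\<^sup>2 \<le> (k + 1)\<^sup>2"
    using k by (intro power_mono) auto
  then have pos: "0 < (k + 1)\<^sup>2 - 8"
    by simp
  have "0 < ((k + 1)\<^sup>2 - 8) * f b"
    unfolding eqs(2) using k S by simp
  then have fb: "0 < f b"
    using pos by (simp add: zero_less_mult_iff)
  show "0 < f i" if "i < n" "i \<noteq> c"
  proof (cases "i \<in> {b, c, d}")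
    case True
    then show ?thesis
      using fb eqs(3) that by auto
  next
    case False
    then have "0 < (k + 1) * f i"
      using eqs(5)[of i] that S by simp
    then show ?thesis
      using k by (simp add: zero_less_mult_iff)
  qed
  show "f c < f i" if i: "i < n" "i \<notin> {b, c, d}"
  proof -
    have "(\<Sum>j<n. sign_matrix (path3 b c d) c j * f j) = k * f c"
      using ef lt by (simp add: is_eigenfun_def)
    then have "(k + 1) * f c = S - 2 * (f b + f d)"
      using row_path3[OF lt(2), of f] ne by (simp add: S_def algebra_simps)
    also have "\<dots> < (k + 1) * f i"
      using eqs(3) eqs(5)[OF i] fb by simp
    finally show ?thesis
      using k by simp
  qed
qed

section \<open>Strict comparisons with the index of the negative path\<close>

text \<open>The entries of a top eigenvector at \<open>b\<close> and \<open>c\<close> have the same sign, so making the edge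
  \<open>bc\<close> positive does not decrease the quadratic form.\<close>

lemma index_path3_less_edge:
  "index n (sign_matrix (path3 b c d)) < index n (sign_matrix {{c, d}})"
proof -
  let ?L = "index n (sign_matrix (path3 b c d))"
  obtain f where nz: "\<exists>i<n. f i \<noteq> 0" and ef: "is_eigenfun n (sign_matrix (path3 b c d)) ?L f"
    using index_eigenfun[of n "sign_matrix (path3 b c d)"] n by (metis gr0I not_numeral_le_zero sign_matrix_commute)
  note L = index_path3_ge_3
  define S where "S = (\<Sum>j<n. f j)"
  define D where "D = (?L + 1)\<^sup>2 - 8"
  note eqs = path3_eigenfun[OF L nz ef, folded S_def D_def]
  have "4\<^sup>2 \<le> (?L + 1)\<^sup>2"
    using L by (intro power_mono) auto
  then have D: "0 < D"
    by (simp add: D_def)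
  \<comment> \<open>The sign of \<open>S\<close> is unknown here, but it enters the product only
    squared.\<close>
  have "D\<^sup>2 * (f b * f c) = (D * f b) * (D * f c)"
    by (simp add: power2_eq_square)
  also have "\<dots> = (?L - 1) * (?L - 3) * S\<^sup>2"
    unfolding eqs(2,4) by (simp add: power2_eq_square)
  finally have "0 \<le> D\<^sup>2 * (f b * f c)"
    using L by simp
  then have bc: "0 \<le> f b * f c"
    using D by (simp add: zero_le_mult_iff)
  have N: "0 < sq_norm n f"
    using nz by (simp add: sq_norm_pos_iff)
  have notin: "{b, c} \<notin> {{c, d}}"
    using ne by (auto simp: doubleton_eq_iff)
  have "?L * sq_norm n f = quad_form n (sign_matrix (path3 b c d)) f"
    using quad_form_eigenfun[OF ef] by simp
  also have "\<dots> = quad_form n (sign_matrix {{c, d}}) f - 4 * (f b * f c)"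
    unfolding path3_def using quad_form_sign_matrix_insert[OF ne(1) notin lt(1,2)] by simp
  finally have *: "?L * sq_norm n f = quad_form n (sign_matrix {{c, d}}) f - 4 * (f b * f c)" .
  have R: "quad_form n (sign_matrix {{c, d}}) f \<le> index n (sign_matrix {{c, d}}) * sq_norm n f"
    using n by (intro quad_form_le_index) (auto simp: sign_matrix_commute)
  then have "?L * sq_norm n f \<le> index n (sign_matrix {{c, d}}) * sq_norm n f"
    using * bc by linarith
  then have le: "?L \<le> index n (sign_matrix {{c, d}})"
    using N by simp
  moreover have "?L \<noteq> index n (sign_matrix {{c, d}})"
  proof
    assume eq: "?L = index n (sign_matrix {{c, d}})"
    have "quad_form n (sign_matrix {{c, d}}) f = index n (sign_matrix {{c, d}}) * sq_norm n f"
      using R bc * unfolding eq by linarith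
    then have "is_eigenfun n (sign_matrix {{c, d}}) ?L f"
      unfolding eq using n by (intro quad_form_eq_index) (auto simp: sign_matrix_commute)
    \<comment> \<open>The two systems are compared in row \<open>c\<close>; row \<open>b\<close>
      would only give \<open>f c = 0\<close>, which is no contradiction when
      \<open>?L = 3\<close>.\<close>
    then have "f b = 0"
      using ef lt ne row_sign_matrix_insert[OF ne(1) notin lt(1,2), of c f]
      by (simp add: is_eigenfun_def path3_def)
    then show False
      using eqs(1,2) L by simp
  qed
  ultimately show ?thesis
    by simp
qed

text \<open>On equality \<open>f\<close> would be an eigenfunction of both matrices and vanish at
  both ends of an edge outside the path, but only the centre admits a zero.\<close>

lemma less_index_path3_supergraph:
  assumes G: "path3 b c d \<subset> G" "G \<subseteq> nsets {..<n} 2"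
    and nonneg: "\<And>i. i < n \<Longrightarrow> 0 \<le> f i" and nz: "\<exists>i<n. f i \<noteq> 0"
    and ef: "is_eigenfun n (sign_matrix G) k f"
  shows "k < index n (sign_matrix (path3 b c d))"
proof -
  let ?L = "index n (sign_matrix (path3 b c d))"
  have N: "0 < sq_norm n f"
    using nz by (simp add: sq_norm_pos_iff)
  have 1: "k * sq_norm n f \<le> quad_form n (sign_matrix (path3 b c d)) f"
    using quad_form_sign_matrix_antimono[of "path3 b c d" G n f] G nonneg quad_form_eigenfun[OF ef]
    by auto
  have 2: "quad_form n (sign_matrix (path3 b c d)) f \<le> ?L * sq_norm n f"
    using n by (intro quad_form_le_index) (auto simp: sign_matrix_commute)
  have "k \<le> ?L"
    using order_trans[OF 1 2] N by simp
  moreover have "k \<noteq> ?L"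
  proof
    assume eq: "k = ?L"
    have ef': "is_eigenfun n (sign_matrix (path3 b c d)) ?L f"
      using n 1 2 eq by (intro quad_form_eq_index) (auto simp: sign_matrix_commute)
    obtain e where e: "e \<in> G - path3 b c d"
      using G(1) by blast
    then have "e \<in> nsets {..<n} 2"
      using G(2) by blast
    then obtain u v where uv: "e = {u, v}" "u \<noteq> v" "u < n" "v < n"
      by (auto simp: nsets_2_eq)
    have "f v = 0"
      using sign_matrix_eigenfun_vanishes[OF psubset_imp_subset[OF G(1)] nonneg ef'[folded eq] ef]
        e uv by blast
    moreover have "f u = 0"
      using sign_matrix_eigenfun_vanishes[OF psubset_imp_subset[OF G(1)] nonneg ef'[folded eq] ef,
          of v u] e uv by (auto simp: insert_commute)
    ultimately show False
      using path3_eigenfun_nonneg(1)[OF index_path3_ge_3 nz ef' nonneg] uv(2-4)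
      by (metis less_irrefl)
  qed
  ultimately show ?thesis
    by simp
qed

text \<open>If \<open>f c \<le> f a\<close>, the matching \<open>ab, cd\<close> can be replaced by the path \<open>bcd\<close>.\<close>

lemma less_index_path3_matching:
  assumes a: "a < n" "a \<notin> {b, c, d}" and ac: "f c \<le> f a"
    and G: "{a, b} \<in> G" "{c, d} \<in> G"
    and nonneg: "\<And>i. i < n \<Longrightarrow> 0 \<le> f i" and nz: "\<exists>i<n. f i \<noteq> 0"
    and ef: "is_eigenfun n (sign_matrix G) k f"
  shows "k < index n (sign_matrix (path3 b c d))"
proof -
  let ?L = "index n (sign_matrix (path3 b c d))"
  have N: "0 < sq_norm n f"
    using nz by (simp add: sq_norm_pos_iff)
  have q: "quad_form n (sign_matrix {{a, b}, {c, d}}) f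
      = quad_form n (sign_matrix {}) f - 4 * f c * f d - 4 * f a * f b"
    using lt ne a quad_form_sign_matrix_insert[of a b "{{c, d}}" n f]
      quad_form_sign_matrix_insert[of c d "{}" n f]
    by (auto simp: doubleton_eq_iff)
  have "k * sq_norm n f \<le> quad_form n (sign_matrix {{a, b}, {c, d}}) f"
    using quad_form_sign_matrix_antimono[of "{{a, b}, {c, d}}" G n f] G nonneg
      quad_form_eigenfun[OF ef] by auto
  \<comment> \<open>Replacing \<open>ab\<close> by \<open>bc\<close> changes the form by
    \<open>4 * f b * (f a - f c)\<close>.\<close>
  then have 1: "k * sq_norm n f
      \<le> quad_form n (sign_matrix (path3 b c d)) f - 4 * (f b * (f a - f c))"
    unfolding q quad_form_path3 by (simp add: algebra_simps)
  have 2: "quad_form n (sign_matrix (path3 b c d)) f \<le> ?L * sq_norm n f"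
    using n by (intro quad_form_le_index) (auto simp: sign_matrix_commute)
  have 3: "0 \<le> f b * (f a - f c)"
    using nonneg[OF lt(1)] ac by simp
  have "k * sq_norm n f \<le> ?L * sq_norm n f"
    using 1 2 3 by linarith
  then have "k \<le> ?L"
    using N by simp
  moreover have "k \<noteq> ?L"
  proof
    assume eq: "k = ?L"
    have "quad_form n (sign_matrix (path3 b c d)) f = ?L * sq_norm n f"
      using 1 2 3 unfolding eq by linarith
    then have ef': "is_eigenfun n (sign_matrix (path3 b c d)) ?L f"
      using n by (intro quad_form_eq_index) (auto simp: sign_matrix_commute)
    \<comment> \<open>The vertex \<open>a\<close> lies off the path, so \<open>f c < f a\<close>
      holds strictly and the exchange gains something after all.\<close>
    have "0 < f b * (f a - f c)"
      using path3_eigenfun_nonneg[OF index_path3_ge_3 nz ef' nonneg] lt ne a by simp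
    then show False
      using 1 2 unfolding eq by linarith
  qed
  ultimately show ?thesis
    by simp
qed

end


section \<open>Switching equivalence\<close>

text \<open>Similarity by a signed permutation: \<open>p\<close> is the isomorphism, and
  \<open>t\<close> is -1 exactly on the switched vertices. In this form equivalences compose and
  invert by plain multiplication of signs.\<close>

definition switch_equiv :: "nat \<Rightarrow> nat set set \<Rightarrow> nat set set \<Rightarrow> bool" where
  "switch_equiv n E E' \<longleftrightarrow>
     (\<exists>p t. bij_betw p {..<n} {..<n} \<and> (\<forall>i<n. t i = 1 \<or> t i = - 1) \<and>
        (\<forall>i<n. \<forall>j<n. sign_matrix E i j = t i * t j * sign_matrix E' (p i) (p j)))"

lemma switch_equivI:
  assumes "bij_betw p {..<n} {..<n}" "\<And>i. i < n \<Longrightarrow> t i = 1 \<or> t i = - 1"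
    and "\<And>i j. i < n \<Longrightarrow> j < n \<Longrightarrow> sign_matrix E i j = t i * t j * sign_matrix E' (p i) (p j)"
  shows "switch_equiv n E E'"
  using assms unfolding switch_equiv_def by blast

lemma switch_equivE:
  assumes "switch_equiv n E E'"
  obtains p t where "bij_betw p {..<n} {..<n}" "\<And>i. i < n \<Longrightarrow> p i < n"
    "\<And>i. i < n \<Longrightarrow> t i = 1 \<or> t i = - 1"
    "\<And>i j. i < n \<Longrightarrow> j < n \<Longrightarrow> sign_matrix E i j = t i * t j * sign_matrix E' (p i) (p j)"
proof -
  obtain p t where *: "bij_betw p {..<n} {..<n}" "\<forall>i<n. t i = 1 \<or> t i = - 1"
      "\<forall>i<n. \<forall>j<n. sign_matrix E i j = t i * t j * sign_matrix E' (p i) (p j)"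
    using assms unfolding switch_equiv_def by blast
  moreover have "p i < n" if "i < n" for i
    using bij_betwE[OF *(1)] that by simp
  ultimately show thesis
    using that by blast
qed

lemma switch_equiv_trans:
  assumes "switch_equiv n E E'" "switch_equiv n E' E''"
  shows "switch_equiv n E E''"
proof -
  obtain p t where 1: "bij_betw p {..<n} {..<n}" "\<And>i. i < n \<Longrightarrow> p i < n"
      "\<And>i. i < n \<Longrightarrow> t i = 1 \<or> t i = - 1"
      "\<And>i j. i < n \<Longrightarrow> j < n \<Longrightarrow> sign_matrix E i j = t i * t j * sign_matrix E' (p i) (p j)"
    using switch_equivE[OF assms(1)] by blast
  obtain q u where 2: "bij_betw q {..<n} {..<n}" "\<And>i. i < n \<Longrightarrow> q i < n"
      "\<And>i. i < n \<Longrightarrow> u i = 1 \<or> u i = - 1"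
      "\<And>i j. i < n \<Longrightarrow> j < n \<Longrightarrow> sign_matrix E' i j = u i * u j * sign_matrix E'' (q i) (q j)"
    using switch_equivE[OF assms(2)] by blast
  show ?thesis
  proof (rule switch_equivI)
    show "bij_betw (q \<circ> p) {..<n} {..<n}"
      using 1(1) 2(1) by (rule bij_betw_trans)
    show "t i * u (p i) = 1 \<or> t i * u (p i) = - 1" if "i < n" for i
      using 1(2,3) 2(3) that by fastforce
    show "sign_matrix E i j = t i * u (p i) * (t j * u (p j)) * sign_matrix E'' ((q \<circ> p) i) ((q \<circ> p) j)"
      if "i < n" "j < n" for i j
      using 1(2,4) 2(4) that by simp
  qed
qed

lemma switch_equiv_sym:
  assumes "switch_equiv n E E'"
  shows "switch_equiv n E' E"
proof -
  obtain p t where 1: "bij_betw p {..<n} {..<n}" "\<And>i. i < n \<Longrightarrow> p i < n"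
      "\<And>i. i < n \<Longrightarrow> t i = 1 \<or> t i = - 1"
      "\<And>i j. i < n \<Longrightarrow> j < n \<Longrightarrow> sign_matrix E i j = t i * t j * sign_matrix E' (p i) (p j)"
    using switch_equivE[OF assms] by blast
  define q where "q = inv_into {..<n} p"
  have q: "bij_betw q {..<n} {..<n}"
    unfolding q_def using 1(1) by (rule bij_betw_inv_into)
  have qn: "q i < n" if "i < n" for i
    using bij_betwE[OF q] that by simp
  have pq: "p (q i) = i" if "i < n" for i
    unfolding q_def using bij_betw_inv_into_right[OF 1(1)] that by simp
  show ?thesis
  proof (rule switch_equivI)
    show "bij_betw q {..<n} {..<n}"
      by (rule q)
    show "t (q i) = 1 \<or> t (q i) = - 1" if "i < n" for i
      using 1(3) qn that by blast
    show "sign_matrix E' i j = t (q i) * t (q j) * sign_matrix E (q i) (q j)"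
      if "i < n" "j < n" for i j
      using 1(3)[OF qn[OF that(1)]] 1(3)[OF qn[OF that(2)]] 1(4)[of "q i" "q j"] qn pq that by auto
  qed
qed

text \<open>Pulling an eigenfunction \<open>g\<close> back to \<open>t i * g (p i)\<close> preserves
  norm and quadratic form, so the Rayleigh principle gives one inequality; symmetry of the
  equivalence gives the other.\<close>

lemma index_switch_equiv:
  assumes "0 < n" "switch_equiv n E E'"
  shows "index n (sign_matrix E) = index n (sign_matrix E')"
proof -
  have *: "index n (sign_matrix E') \<le> index n (sign_matrix E)" if eqv: "switch_equiv n E E'" for E E'
  proof -
    obtain p t where 1: "bij_betw p {..<n} {..<n}" "\<And>i. i < n \<Longrightarrow> p i < n"
        "\<And>i. i < n \<Longrightarrow> t i = 1 \<or> t i = - 1"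
        "\<And>i j. i < n \<Longrightarrow> j < n \<Longrightarrow> sign_matrix E i j = t i * t j * sign_matrix E' (p i) (p j)"
      using switch_equivE[OF eqv] by blast
    obtain g where nz: "\<exists>i<n. g i \<noteq> 0"
      and ef: "is_eigenfun n (sign_matrix E') (index n (sign_matrix E')) g"
      using index_eigenfun[OF assms(1), of "sign_matrix E'"] by (metis sign_matrix_commute)
    define f where "f i = t i * g (p i)" for i
    have tt: "t i * t i = 1" if "i < n" for i
      using 1(3)[OF that] by auto
    have "sq_norm n f = (\<Sum>i<n. (g (p i))\<^sup>2)"
      unfolding sq_norm_def f_def using tt
      by (intro sum.cong) (auto simp: power_mult_distrib power2_eq_square)
    also have "\<dots> = sq_norm n g"
      unfolding sq_norm_def by (rule sum.reindex_bij_betw[OF 1(1)])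
    finally have N: "sq_norm n f = sq_norm n g" .
    have "sign_matrix E i j * f i * f j = sign_matrix E' (p i) (p j) * g (p i) * g (p j)"
      if "i < n" "j < n" for i j
      using 1(3)[OF that(1)] 1(3)[OF that(2)] 1(4)[OF that] by (auto simp: f_def)
    then have "quad_form n (sign_matrix E) f
        = (\<Sum>i<n. \<Sum>j<n. sign_matrix E' (p i) (p j) * g (p i) * g (p j))"
      unfolding quad_form_def by (intro sum.cong) auto
    also have "\<dots> = (\<Sum>i<n. \<Sum>j<n. sign_matrix E' (p i) j * g (p i) * g j)"
      by (intro sum.cong refl sum.reindex_bij_betw[OF 1(1)])
    also have "\<dots> = quad_form n (sign_matrix E') g"
      unfolding quad_form_def
      by (rule sum.reindex_bij_betw[OF 1(1), of "\<lambda>i. \<Sum>j<n. sign_matrix E' i j * g i * g j"])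
    finally have Q: "quad_form n (sign_matrix E) f = quad_form n (sign_matrix E') g" .
    have "index n (sign_matrix E') * sq_norm n g \<le> index n (sign_matrix E) * sq_norm n g"
      using quad_form_le_index[OF assms(1), of "sign_matrix E" f] quad_form_eigenfun[OF ef]
      by (simp add: N Q sign_matrix_commute)
    then show ?thesis
      using nz by (simp flip: sq_norm_pos_iff)
  qed
  show ?thesis
    using *[OF assms(2)] *[OF switch_equiv_sym[OF assms(2)]] by simp
qed

lemma switching_isomorphic_if_switch_equiv:
  assumes "switch_equiv n (edges H) (edges H')"
  shows "switching_isomorphic (signed_complete n H) (signed_complete n H')"
proof -
  obtain p t where 1: "bij_betw p {..<n} {..<n}" "\<And>i. i < n \<Longrightarrow> p i < n"
      "\<And>i. i < n \<Longrightarrow> t i = 1 \<or> t i = - 1"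
      "\<And>i j. i < n \<Longrightarrow> j < n \<Longrightarrow>
        sign_matrix (edges H) i j = t i * t j * sign_matrix (edges H') (p i) (p j)"
    using switch_equivE[OF assms] by blast
  \<comment> \<open>Switching takes place in the target graph, so the vertices with sign -1 are
    carried over by \<open>p\<close>.\<close>
  define U where "U = p ` {i. i < n \<and> t i = - 1}"
  have inj: "p i = p j \<longleftrightarrow> i = j" if "i < n" "j < n" for i j
    using bij_betw_imp_inj_on[OF 1(1)] that by (auto simp: inj_on_def)
  have U: "p i \<in> U \<longleftrightarrow> t i = - 1" if "i < n" for i
    using that inj by (auto simp: U_def)
  have "is_graph_iso p (signed_complete n H) (switch U (signed_complete n H'))"
  proof -
    have "(`) p ` nsets {..<n} 2 = nsets {..<n} 2"
      using bij_betw_nsets[OF 1(1), of 2] by (rule bij_betw_imp_surj_on)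
    then show ?thesis
      using 1(1) by (simp add: is_graph_iso_def signed_complete_def complete_graph_def switch_def)
  qed
  moreover have "esign (switch U (signed_complete n H')) (p ` e) = esign (signed_complete n H) e"
    if "e \<in> edges (signed_complete n H)" for e
  proof -
    have "e \<in> nsets {..<n} 2"
      using that by (simp add: signed_complete_def complete_graph_def)
    then obtain i j where e: "e = {i, j}" "i < n" "j < n" "i \<noteq> j"
      by (auto simp: nsets_2_eq)
    have "p i \<noteq> p j"
      using inj e by simp
    then show ?thesis
      using 1(4)[OF e(2,3)] 1(3)[OF e(2)] 1(3)[OF e(3)] U[OF e(2)] U[OF e(3)] e(1,4)
      by (auto simp: switch_def signed_complete_def sign_matrix_def split: if_splits)
  qed
  ultimately have "signed_isomorphic (signed_complete n H) (switch U (signed_complete n H'))"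
    by (auto simp: signed_isomorphic_def)
  moreover have "U \<subseteq> vertices (signed_complete n H')"
    using 1(2) by (auto simp: U_def signed_complete_def complete_graph_def)
  ultimately show ?thesis
    by (auto simp: switching_isomorphic_def)
qed

section \<open>Balance of the all-positive switching class\<close>

text \<open>Turns the parity in the definition of balance into a product of signs.\<close>

lemma prod_sign:
  fixes s :: "'a \<Rightarrow> real"
  assumes "finite A" "\<And>x. x \<in> A \<Longrightarrow> s x = 1 \<or> s x = - 1"
  shows "prod s A = (- 1) ^ card {x \<in> A. s x = - 1}"
  using assms
proof (induction A rule: finite_induct)
  case (insert x A)
  have "{y \<in> insert x A. s y = - 1} =
      (if s x = - 1 then insert x {y \<in> A. s y = - 1} else {y \<in> A. s y = - 1})"
    by auto
  moreover have "s x = 1 \<or> s x = - 1"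
    using insert.prems by simp
  ultimately show ?case
    using insert by auto
qed simp

text \<open>Along a cycle the signs \<open>t i * t j\<close> of the edges \<open>ij\<close> multiply to \<open>1\<close>, as every vertex
  contributes twice.\<close>

lemma balanced_if_switch_equiv_empty:
  assumes "switch_equiv n (edges H) {}"
  shows "balanced (signed_complete n H)"
  unfolding balanced_def
proof (intro allI impI)
  fix vs
  assume "is_cycle (signed_complete n H) vs"
  then have vs: "3 \<le> length vs" "distinct vs" "set vs \<subseteq> {..<n}"
    by (auto simp: is_cycle_def signed_complete_def complete_graph_def)
  obtain p t where 1: "bij_betw p {..<n} {..<n}" "\<And>i. i < n \<Longrightarrow> p i < n"
      "\<And>i. i < n \<Longrightarrow> t i = 1 \<or> t i = - 1"
      "\<And>i j. i < n \<Longrightarrow> j < n \<Longrightarrow> sign_matrix (edges H) i j = t i * t j * sign_matrix {} (p i) (p j)"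
    using switch_equivE[OF assms] by blast
  define l where "l = length vs"
  define e where "e i = {vs ! i, vs ! (Suc i mod l)}" for i
  define s where "s x = real_of_int (esign (signed_complete n H) x)" for x
  have l: "3 \<le> l"
    using vs(1) by (simp add: l_def)
  have nth: "vs ! i = vs ! j \<longleftrightarrow> i = j" if "i < l" "j < l" for i j
    using nth_eq_iff_index_eq[OF vs(2)] that by (simp add: l_def)
  have nthn: "vs ! i < n" if "i < l" for i
    using subsetD[OF vs(3) nth_mem, of i] that by (simp add: l_def)
  have next_lt: "Suc i mod l < l" for i
    using l by simp
  have "inj_on (\<lambda>i. Suc i mod l) {..<l}"
    by (auto simp: inj_on_def mod_Suc split: if_splits)
  then have bij: "bij_betw (\<lambda>i. Suc i mod l) {..<l} {..<l}"
    using next_lt endo_inj_surj[of "{..<l}" "\<lambda>i. Suc i mod l"] by (auto simp: bij_betw_def)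
  \<comment> \<open>Positions and edges of the cycle correspond one to one: two positions with the
    same edge would be successors of each other, impossible for \<open>3 \<le> l\<close>.\<close>
  have inj: "inj_on e {..<l}"
  proof (rule inj_onI)
    fix i j
    assume "i \<in> {..<l}" "j \<in> {..<l}" "e i = e j"
    then have "i = j \<or> i = Suc j mod l \<and> Suc i mod l = j"
      using nth next_lt by (auto simp: e_def doubleton_eq_iff)
    then show "i = j"
      using l \<open>i \<in> {..<l}\<close> \<open>j \<in> {..<l}\<close> by (auto simp: mod_Suc split: if_splits)
  qed
  have ce: "cycle_edges vs = e ` {..<l}"
    by (auto simp: cycle_edges_def e_def l_def)
  have se: "s (e i) = t (vs ! i) * t (vs ! (Suc i mod l))" if "i < l" for i
  proof -
    have "i \<noteq> Suc i mod l"
      using l that by (auto simp: mod_Suc)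
    then have ne: "vs ! i \<noteq> vs ! (Suc i mod l)"
      using nth next_lt that by simp
    then have "p (vs ! i) \<noteq> p (vs ! (Suc i mod l))"
      using bij_betw_imp_inj_on[OF 1(1)] nthn next_lt that by (auto simp: inj_on_def)
    then show ?thesis
      using 1(4)[OF nthn[OF that] nthn[OF next_lt[of i]]] ne
      by (simp add: s_def e_def sign_matrix_def signed_complete_def split: if_splits)
  qed
  have "prod s (cycle_edges vs) = (\<Prod>i<l. s (e i))"
    unfolding ce using prod.reindex[OF inj, of s] by simp
  also have "\<dots> = (\<Prod>i<l. t (vs ! i)) * (\<Prod>i<l. t (vs ! (Suc i mod l)))"
    by (simp add: se prod.distrib)
  also have "(\<Prod>i<l. t (vs ! (Suc i mod l))) = (\<Prod>i<l. t (vs ! i))"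
    by (rule prod.reindex_bij_betw[OF bij])
  also have "(\<Prod>i<l. t (vs ! i)) * (\<Prod>i<l. t (vs ! i)) = (\<Prod>i<l. 1)"
    unfolding prod.distrib[symmetric] using 1(3) nthn by (intro prod.cong) fastforce+
  finally have "prod s (cycle_edges vs) = 1"
    by simp
  moreover have "prod s (cycle_edges vs) = (- 1) ^ card {x \<in> cycle_edges vs. s x = - 1}"
    by (rule prod_sign) (auto simp: ce s_def signed_complete_def)
  ultimately have "even (card {x \<in> cycle_edges vs. s x = - 1})"
    by (metis neg_one_odd_power one_neq_neg_one)
  moreover have "s x = - 1 \<longleftrightarrow> esign (signed_complete n H) x = - 1" for x
    by (auto simp: s_def signed_complete_def)
  ultimately show "even (card {x \<in> cycle_edges vs. esign (signed_complete n H) x = - 1})"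
    by simp
qed

section \<open>Switching classes of the two extremal graphs\<close>

lemma edge_D1_iff:
  assumes "x < n" "y < n"
  shows "{x, y} \<in> edges (D1 n) \<longleftrightarrow>
    x = 0 \<and> y \<notin> {0, 2} \<or> y = 0 \<and> x \<notin> {0, 2} \<or> x = 1 \<and> y = 2 \<or> x = 2 \<and> y = 1"
proof -
  have small: "z = 0 \<or> z = 1 \<or> z = 2 \<or> 3 \<le> z" for z :: nat
    by linarith
  show ?thesis
    using small[of x] small[of y] assms
    by (elim disjE) (auto simp: D1_def doubleton_eq_iff)
qed

lemma edge_U1_iff:
  assumes "x < n" "y < n"
  shows "{x, y} \<in> edges (U1 n) \<longleftrightarrow>
    x = 0 \<and> y \<noteq> 0 \<or> y = 0 \<and> x \<noteq> 0 \<or> x = 1 \<and> y = 2 \<or> x = 2 \<and> y = 1"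
proof -
  have small: "z = 0 \<or> z = 1 \<or> z = 2 \<or> 3 \<le> z" for z :: nat
    by linarith
  show ?thesis
    using small[of x] small[of y] assms
    by (elim disjE) (auto simp: U1_def doubleton_eq_iff)
qed

text \<open>The complements of the two triples have equal size, so any bijection between them
  completes the prescribed values.\<close>

lemma bij_betw_three_points:
  fixes b c d x y z n :: nat
  assumes "b < n" "c < n" "d < n" "b \<noteq> c" "c \<noteq> d" "b \<noteq> d"
    and "x < n" "y < n" "z < n" "x \<noteq> y" "y \<noteq> z" "x \<noteq> z"
  obtains p where "bij_betw p {..<n} {..<n}" "p b = x" "p c = y" "p d = z"
proof -
  have "card ({..<n} - {b, c, d}) = card ({..<n} - {x, y, z})"
    using assms by (subst (1 2) card_Diff_subset) auto
  then obtain h where h: "bij_betw h ({..<n} - {b, c, d}) ({..<n} - {x, y, z})"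
    using finite_same_card_bij[of "{..<n} - {b, c, d}" "{..<n} - {x, y, z}"] by auto
  define p where "p i = (if i = b then x else if i = c then y else if i = d then z else h i)" for i
  have "bij_betw p ({..<n} - {b, c, d}) ({..<n} - {x, y, z})"
    using h by (rule bij_betw_cong[THEN iffD1, rotated]) (auto simp: p_def)
  moreover have "bij_betw p {b, c, d} {x, y, z}"
    using assms by (auto simp: bij_betw_def inj_on_def p_def)
  ultimately have "bij_betw p (({..<n} - {b, c, d}) \<union> {b, c, d}) (({..<n} - {x, y, z}) \<union> {x, y, z})"
    by (rule bij_betw_combine) auto
  moreover have "({..<n} - {b, c, d}) \<union> {b, c, d} = {..<n}" "({..<n} - {x, y, z}) \<union> {x, y, z} = {..<n}"
    using assms by auto
  ultimately show thesis
    using that[of p] assms by (simp add: p_def)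
qed

context
  fixes n b c d :: nat
  assumes n: "5 \<le> n" and lt: "b < n" "c < n" "d < n" and ne: "b \<noteq> c" "c \<noteq> d" "b \<noteq> d"
begin

text \<open>In \<open>D1 n\<close> vertex 0 is adjacent to all others except 2. Switching at 0
  leaves the negative edges 02 and 12, a path with centre 2; hence \<open>c\<close> goes to
  2.\<close>

lemma switch_equiv_path3_D1: "switch_equiv n (path3 b c d) (edges (D1 n))"
proof -
  obtain p where p: "bij_betw p {..<n} {..<n}" "p b = 0" "p c = 2" "p d = 1"
    using bij_betw_three_points[OF lt ne, of 0 2 1] n by auto
  have inj: "p i = p j \<longleftrightarrow> i = j" if "i < n" "j < n" for i j
    using bij_betw_imp_inj_on[OF p(1)] that by (auto simp: inj_on_def)
  have pn: "p i < n" if "i < n" for i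
    using bij_betwE[OF p(1)] that by simp
  show ?thesis
  proof (rule switch_equivI[OF p(1)])
    fix i j
    assume ij: "i < n" "j < n"
    have "i = b \<longleftrightarrow> p i = 0" "i = c \<longleftrightarrow> p i = 2" "i = d \<longleftrightarrow> p i = 1"
      and "j = b \<longleftrightarrow> p j = 0" "j = c \<longleftrightarrow> p j = 2" "j = d \<longleftrightarrow> p j = 1"
      using inj[of i] inj[of j] ij lt p(2-4) by metis+
    then show "sign_matrix (path3 b c d) i j = (if p i = 0 then - 1 else 1) *
        (if p j = 0 then - 1 else 1) * sign_matrix (edges (D1 n)) (p i) (p j)"
      using inj[OF ij] edge_D1_iff[OF pn[OF ij(1)] pn[OF ij(2)]]
      by (auto simp: sign_matrix_def path3_def doubleton_eq_iff)
  qed auto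
qed

text \<open>In \<open>U1 n\<close> vertex 0 is adjacent to all others, so switching at 0 leaves only
  the negative edge 12. The vertex \<open>b\<close> is the one sent to 0.\<close>

lemma switch_equiv_edge_U1: "switch_equiv n {{c, d}} (edges (U1 n))"
proof -
  obtain p where p: "bij_betw p {..<n} {..<n}" "p b = 0" "p c = 1" "p d = 2"
    using bij_betw_three_points[OF lt ne, of 0 1 2] n by auto
  have inj: "p i = p j \<longleftrightarrow> i = j" if "i < n" "j < n" for i j
    using bij_betw_imp_inj_on[OF p(1)] that by (auto simp: inj_on_def)
  have pn: "p i < n" if "i < n" for i
    using bij_betwE[OF p(1)] that by simp
  show ?thesis
  proof (rule switch_equivI[OF p(1)])
    fix i j
    assume ij: "i < n" "j < n"
    have "i = c \<longleftrightarrow> p i = 1" "i = d \<longleftrightarrow> p i = 2" "j = c \<longleftrightarrow> p j = 1" "j = d \<longleftrightarrow> p j = 2"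
      using inj[of i] inj[of j] ij lt p(2-4) by metis+
    then show "sign_matrix {{c, d}} i j = (if p i = 0 then - 1 else 1) *
        (if p j = 0 then - 1 else 1) * sign_matrix (edges (U1 n)) (p i) (p j)"
      using inj[OF ij] edge_U1_iff[OF pn[OF ij(1)] pn[OF ij(2)]]
      by (auto simp: sign_matrix_def doubleton_eq_iff)
  qed auto
qed

end

section \<open>Reduction of an arbitrary switching class to the negative path\<close>

text \<open>Two intersecting edges form a path, proper in \<open>G\<close> by
  \<open>not_path\<close>; two disjoint edges form a matching, and comparing \<open>f a\<close> with
  \<open>f c\<close> decides which edge is moved.\<close>

lemma less_index_path3:
  assumes n: "5 \<le> n" and G: "G \<subseteq> nsets {..<n} 2"
    and nonneg: "\<And>i. i < n \<Longrightarrow> 0 \<le> f i" and nz: "\<exists>i<n. f i \<noteq> 0"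
    and ef: "is_eigenfun n (sign_matrix G) k f"
    and e: "e \<in> G" "e' \<in> G" "e \<noteq> e'"
    and not_path: "\<And>b c d. b < n \<Longrightarrow> c < n \<Longrightarrow> d < n \<Longrightarrow> b \<noteq> c \<Longrightarrow> c \<noteq> d \<Longrightarrow> b \<noteq> d \<Longrightarrow> G \<noteq> path3 b c d"
  obtains b c d where "b < n" "c < n" "d < n" "b \<noteq> c" "c \<noteq> d" "b \<noteq> d"
    "k < index n (sign_matrix (path3 b c d))"
proof -
  have "e \<in> nsets {..<n} 2" "e' \<in> nsets {..<n} 2"
    using e G by blast+
  then obtain a b c d where ab: "e = {a, b}" "a < n" "b < n" "a \<noteq> b"
    and cd: "e' = {c, d}" "c < n" "d < n" "c \<noteq> d"
    by (auto simp: nsets_2_eq)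
  show thesis
  proof (cases "e \<inter> e' = {}")
    case False
    then obtain x y z where "e = {y, x}" "e' = {x, z}"
      using ab(1) cd(1) by (auto simp: insert_commute)
    moreover from this have "x < n" "y < n" "z < n" "y \<noteq> x" "x \<noteq> z" "y \<noteq> z"
      using ab cd e(3) by (auto simp: doubleton_eq_iff)
    moreover from calculation have "path3 y x z \<subset> G"
      using e not_path[of y x z] by (auto simp: path3_def)
    ultimately show thesis
      using that less_index_path3_supergraph[OF n _ _ _ _ _ _ _ G nonneg nz ef] by blast
  next
    case True
    then have ne: "a \<noteq> c" "a \<noteq> d" "b \<noteq> c" "b \<noteq> d"
      using ab(1) cd(1) by auto
    have G': "{a, b} \<in> G" "{c, d} \<in> G"
      using e ab(1) cd(1) by auto
    show thesis
    proof (cases "f c \<le> f a")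
      case True
      have "k < index n (sign_matrix (path3 b c d))"
        using ab cd ne
        by (intro less_index_path3_matching[OF n _ _ _ _ _ _ _ _ True G'(1,2) nonneg nz ef]) auto
      then show thesis
        using that ab cd ne by blast
    next
      case False
      then have "f a \<le> f c"
        by simp
      \<comment> \<open>The two edges exchange roles: \<open>a\<close> with \<open>c\<close> and
        \<open>b\<close> with \<open>d\<close>.\<close>
      then have "k < index n (sign_matrix (path3 d a b))"
        using ab cd ne
        by (intro less_index_path3_matching[OF n _ _ _ _ _ _ _ _ _ G'(2,1) nonneg nz ef])
          auto
      then show thesis
        using that[of d a b] ab cd ne by blast
    qed
  qed
qed

text \<open>Conjugation by the diagonal matrix of the signs of \<open>g\<close> turns
  \<open>g\<close> into its absolute value and keeps the eigenvalue.\<close>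

lemma switch_to_nonneg_eigenfun:
  assumes "0 < n"
  obtains G f where "G \<subseteq> nsets {..<n} 2" "switch_equiv n E G" "\<And>i. 0 \<le> f i" "\<exists>i<n. f i \<noteq> 0"
    "is_eigenfun n (sign_matrix G) (index n (sign_matrix E)) f"
proof -
  obtain g where nz: "\<exists>i<n. g i \<noteq> 0"
    and ef: "is_eigenfun n (sign_matrix E) (index n (sign_matrix E)) g"
    using index_eigenfun[OF assms, of "sign_matrix E"] by (metis sign_matrix_commute)
  define t where "t i = (if g i < 0 then - 1 else 1 :: real)" for i
  have abs: "\<bar>g i\<bar> = t i * g i" for i
    by (simp add: t_def)
  have tt: "t i * t i = 1" for i
    by (simp add: t_def)
  \<comment> \<open>The negative pairs of the conjugated matrix, restricted to vertices below
    \<open>n\<close>.\<close>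
  define G where "G = {{i, j} | i j. i < n \<and> j < n \<and> i \<noteq> j \<and> t i * t j * sign_matrix E i j = - 1}"
  have mem: "{i, j} \<in> G \<longleftrightarrow> t i * t j * sign_matrix E i j = - 1" if "i < n" "j < n" "i \<noteq> j" for i j
    unfolding G_def using that by (auto simp: doubleton_eq_iff sign_matrix_commute mult.commute)
  have sG: "sign_matrix G i j = t i * t j * sign_matrix E i j" if "i < n" "j < n" for i j
  proof (cases "i = j")
    case False
    then show ?thesis
      using mem[OF that False]
      by (auto simp: sign_matrix_def[of G]) (auto simp: sign_matrix_def t_def split: if_splits)
  qed (simp add: sign_matrix_def)
  have "G \<subseteq> nsets {..<n} 2"
    by (auto simp: G_def)
  moreover have "switch_equiv n E G"
    by (rule switch_equivI[of id _ t]) (auto simp: sG t_def)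
  moreover have "is_eigenfun n (sign_matrix G) (index n (sign_matrix E)) (\<lambda>i. \<bar>g i\<bar>)"
    unfolding is_eigenfun_def
  proof (intro allI impI)
    fix i
    assume i: "i < n"
    have "(\<Sum>j<n. sign_matrix G i j * \<bar>g j\<bar>) = (\<Sum>j<n. t i * (sign_matrix E i j * g j))"
    proof (intro sum.cong refl)
      fix j
      assume "j \<in> {..<n}"
      then have "sign_matrix G i j * \<bar>g j\<bar> = (t j * t j) * (t i * (sign_matrix E i j * g j))"
        using i by (simp add: sG abs)
      then show "sign_matrix G i j * \<bar>g j\<bar> = t i * (sign_matrix E i j * g j)"
        by (simp add: tt)
    qed
    also have "\<dots> = index n (sign_matrix E) * \<bar>g i\<bar>"
      using ef i by (simp add: is_eigenfun_def abs flip: sum_distrib_left)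
    finally show "(\<Sum>j<n. sign_matrix G i j * \<bar>g j\<bar>) = index n (sign_matrix E) * \<bar>g i\<bar>" .
  qed
  ultimately show thesis
    using that[of G "\<lambda>i. \<bar>g i\<bar>"] nz by auto
qed

theorem theorem1p1:
  fixes n :: nat and H :: "nat graph" and \<Gamma> :: "nat signed_graph"
  assumes "5 \<le> n"
    and "spanning_subgraph H (complete_graph n)"
    and "minor_free K22 H"
    and "\<Gamma> = signed_complete n H"
    and "\<not> balanced \<Gamma>"
    and "\<not> switching_isomorphic \<Gamma> (signed_complete n (U1 n))"
    and "\<not> switching_isomorphic \<Gamma> (signed_complete n (D1 n))"
  shows "largest_eigenvalue (adjacency_matrix (signed_complete n (U1 n)))
           > largest_eigenvalue (adjacency_matrix (signed_complete n (D1 n)))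
       \<and> largest_eigenvalue (adjacency_matrix (signed_complete n (D1 n)))
           > largest_eigenvalue (adjacency_matrix \<Gamma>)"
proof -
  have n: "0 < n"
    using assms(1) by simp
  note not_equiv = assms(5-7)[unfolded assms(4)]
  \<comment> \<open>The position of the path is irrelevant: each one has the index of
    \<open>D1 n\<close>.\<close>
  have index_D1: "index n (sign_matrix (path3 b c d)) = index n (sign_matrix (edges (D1 n)))"
    if "b < n" "c < n" "d < n" "b \<noteq> c" "c \<noteq> d" "b \<noteq> d" for b c d
    using index_switch_equiv[OF n switch_equiv_path3_D1[OF assms(1) that]] .
  have "index n (sign_matrix (path3 0 1 2)) < index n (sign_matrix {{1, 2}})"
    using index_path3_less_edge[OF assms(1), of 0 1 2] assms(1) by simp
  moreover have "index n (sign_matrix {{1, 2}}) = index n (sign_matrix (edges (U1 n)))"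
    using index_switch_equiv[OF n switch_equiv_edge_U1[OF assms(1), of 0 1 2]] assms(1) by simp
  ultimately have U1: "index n (sign_matrix (edges (D1 n))) < index n (sign_matrix (edges (U1 n)))"
    using index_D1[of 0 1 2] assms(1) by simp
  obtain G f where G: "G \<subseteq> nsets {..<n} 2" "switch_equiv n (edges H) G"
    and f: "\<And>i. 0 \<le> f i" "\<exists>i<n. f i \<noteq> 0"
      "is_eigenfun n (sign_matrix G) (index n (sign_matrix (edges H))) f"
    using switch_to_nonneg_eigenfun[OF n, of "edges H"] by blast
  have "G \<noteq> {}"
    using G(2) balanced_if_switch_equiv_empty not_equiv(1) by blast
  then obtain e where e: "e \<in> G"
    by blast
  have "G \<noteq> {e}"
  proof
    assume Ge: "G = {e}"
    with G(1) obtain c d where cd: "G = {{c, d}}" "c < n" "d < n" "c \<noteq> d"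
      by (auto simp: nsets_2_eq)
    \<comment> \<open>A third vertex is needed to play the role of vertex 0 of
      \<open>U1 n\<close>.\<close>
    obtain b where "b \<in> {..<n} - {c, d}"
    proof -
      have "card {c, d} < card {..<n}"
        using assms(1) card_insert_le_m1[of 2 "{d}" c] by simp
      then have "\<not> {..<n} \<subseteq> {c, d}"
        by (metis card_mono finite.emptyI finite.insertI not_le)
      then show thesis
        using that by blast
    qed
    then have "switch_equiv n G (edges (U1 n))"
      unfolding cd(1) using assms(1) cd by (intro switch_equiv_edge_U1[of n b]) auto
    then show False
      using G(2) not_equiv(2) switch_equiv_trans switching_isomorphic_if_switch_equiv by blast
  qed
  then obtain e' where e': "e' \<in> G" "e \<noteq> e'"
    using e by blast
  have "G \<noteq> path3 b c d" if "b < n" "c < n" "d < n" "b \<noteq> c" "c \<noteq> d" "b \<noteq> d" for b c d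
    using switch_equiv_path3_D1[OF assms(1) that] G(2) not_equiv(3) switch_equiv_trans
      switching_isomorphic_if_switch_equiv by blast
  then obtain b c d where "b < n" "c < n" "d < n" "b \<noteq> c" "c \<noteq> d" "b \<noteq> d"
    "index n (sign_matrix (edges H)) < index n (sign_matrix (path3 b c d))"
    using less_index_path3[OF assms(1) G(1) f(1) f(2,3) e e'] by blast
  then show ?thesis
    using U1 index_D1 by (simp add: assms(4) largest_eigenvalue_signed_complete)
qed

end
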